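(* Let $\Omega\subset\mathbb{R}^2$ be a smooth bounded domain such that the connected components of $\partial\Omega$ are $C^2$-smooth closed curves without self-intersections, and let $b:\Omega\to\mathbb{R}$ be a locally Lipschitz magnetic field. Consider a connected component $\mathcal{C}$ of $\partial\Omega$, of length $L$, with signed curvature $\kappa$, tubular coordinates $(n,s)\in(0,\delta)\times\mathbb{R}/L\mathbb{Z}$ given by $q=\psi(n,s)$, and magnetic field $B(n,s)$ in these coordinates (see context). Let $$K=\sup_{s\in\mathbb{R}/L\mathbb{Z}}|\kappa(s)|,\qquad K'=\sup_{s\in\mathbb{R}/L\mathbb{Z}}|\kappa'(s)|.$$ Assume that, for some $\epsilon\in(0,1)$, $\delta$ satisfies $0<\delta\le\epsilon/K$. Assume that there exists $M\ge0$ such that, for all $(n,s)\in(0,\delta)\times\mathbb{R}/L\mathbb{Z}$, $$\left|B(n,s)-\frac1L\int_0^LB(n,\xi)\,\mathrm{d}\xi\right|\le M.$$ Consider $T>0$ and a trajectory $q(t)=\psi(n(t),s(t))$ contained in $\Omega_{\mathcal{C}}(\delta)$ for $t\in[0,T]$, with energy $H_0$. Let $$f(n)=-\frac1L\int_n^\delta\int_0^LB(\eta,\xi)\,\mathrm{d}\xi\,\mathrm{d}\eta$$ and assume that $$\liminf_{n\to0}|f(n)|>C(T),$$ where $$C(T)=\left|\dot s(0)\,[1-\kappa(s(0))n(0)]+\int_{n(0)}^\delta\int_0^LB(\eta,\xi)\,\mathrm{d}\xi\,\mathrm{d}\eta\right|+\sqrt{2H_0}\,(1+\epsilon)+\left(M\sqrt{2H_0}+\frac{2H_0K'\delta}{1-\epsilon}\right)T.$$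 Let $g$ be a continuous and strictly decreasing function such that $$\lim_{n\to0}g(n)=\liminf_{n\to0}|f(n)|,\qquad g\le|f|\ \text{ on }[0,\delta]$$ (such a function $g$ always exists). Then $g$ takes the value $C(T)$ and, for all $t\in[0,T)$, $$n(t)>g^{-1}(C(T)).$$
   Context: **Dynamics.** The particle has unit charge and mass and moves in $\Omega$ according to Newton's equation $\ddot q=b(q)\,(\dot q_2,-\dot q_1)$, where $q=(q_1,q_2)$. Equivalently, it follows the Hamiltonian flow of $\mathcal{H}(q,p)=\frac12\|p-\mathbf{A}(q)\|^2$ with $p=\dot q+\mathbf{A}(q)$, where $\mathbf{A}=(A_1,A_2)$ is a $C^1$ vector potential satisfying $\partial_{q_1}A_2-\partial_{q_2}A_1=b$. The energy $\mathcal{H}=\frac12\|\dot q\|^2$ is conserved, and $H_0$ denotes its value along the trajectory. A trajectory is a solution of this system. **Tubular coordinates.** Let $\gamma:\mathbb{R}/L\mathbb{Z}\to\mathcal{C}$ be the arc-length parametrization of $\mathcal{C}$. Let $N(s)$ be the inward pointing unit normal at $\gamma(s)$, with $\gamma$ oriented so that $(\gamma'(s),N(s))$ is a direct orthonormal basis. Let $\kappa(s)$ be the signed curvature, $\gamma''(s)=\kappa(s)N(s)$. The number $\delta>0$ is such that $\psi(n,s)=\gamma(s)+nN(s)$ is a smooth diffeomorphism from $(0,\delta)\times\mathbb{R}/L\mathbb{Z}$ onto $\Omega_{\mathcal{C}}(\delta)=\{q\in\Omega:\mathrm{dist}(q,\mathcal{C})<\delta\}$. In these coordinates, $$B(n,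s):=-\,b(\psi(n,s))\,(1-n\kappa(s)).$$
   Formalization: The first summand of C(T) is corrected to |ṡ(0)[1-κ(s(0))n(0)]^2-(1/L)∫_{n(0)}^δ∫_0^L B dξdη| (square, sign and factor 1/L; the printed form fails), and H_0>0 is assumed, since for a particle at rest the strict inequality can fail. *)

theory Defs
  imports "HOL-Analysis.Analysis"
begin

definition tangent :: "(real \<Rightarrow> real^2) \<Rightarrow> real \<Rightarrow> real^2" where
  "tangent \<gamma> s = vector_derivative \<gamma> (at s)"

(* The tangent rotated by +90 degrees, so that (tangent, normal) is a direct basis. *)
definition normal :: "(real \<Rightarrow> real^2) \<Rightarrow> real \<Rightarrow> real^2" where
  "normal \<gamma> s = vector [- (tangent \<gamma> s $ 2), tangent \<gamma> s $ 1]"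

(* Functions on the circle R/LZ are represented by L-periodic functions on the real line. *)
definition arclength_param :: "(real \<Rightarrow> real^2) \<Rightarrow> real \<Rightarrow> (real^2) set \<Rightarrow> bool" where
  "arclength_param \<gamma> L C \<longleftrightarrow>
     0 < L \<and> (\<forall>s. \<gamma> (s + L) = \<gamma> s) \<and> inj_on \<gamma> {0..<L} \<and> \<gamma> ` {0..<L} = C \<and>
     \<gamma> C1_differentiable_on UNIV \<and> tangent \<gamma> C1_differentiable_on UNIV \<and>
     (\<forall>s. norm (tangent \<gamma> s) = 1)"

definition C2_simple_closed_curve :: "(real^2) set \<Rightarrow> bool" where
  "C2_simple_closed_curve C \<longleftrightarrow> (\<exists>\<gamma> L. arclength_param \<gamma> L C)"

definition smooth_bounded_domain :: "(real^2) set \<Rightarrow> bool" where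
  "smooth_bounded_domain \<Omega> \<longleftrightarrow>
     open \<Omega> \<and> connected \<Omega> \<and> bounded \<Omega> \<and> \<Omega> \<noteq> {} \<and>
     (\<forall>C \<in> components (frontier \<Omega>). C2_simple_closed_curve C)"

(* The library notion local_lipschitz concerns time-dependent maps; here time is a dummy. *)
definition locally_lipschitz_field :: "(real^2) set \<Rightarrow> (real^2 \<Rightarrow> real) \<Rightarrow> bool" where
  "locally_lipschitz_field \<Omega> b \<longleftrightarrow> local_lipschitz (UNIV :: real set) \<Omega> (\<lambda>_. b)"

definition inward_normal :: "(real^2) set \<Rightarrow> (real \<Rightarrow> real^2) \<Rightarrow> bool" where
  "inward_normal \<Omega> \<gamma> \<longleftrightarrow>
     (\<forall>s. \<exists>r>0. \<forall>n\<in>{0<..<r}. \<gamma> s + n *\<^sub>R normal \<gamma> s \<in> \<Omega>)"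

definition tube :: "(real^2) set \<Rightarrow> (real^2) set \<Rightarrow> real \<Rightarrow> (real^2) set" where
  "tube \<Omega> C \<delta> = {q \<in> \<Omega>. infdist q C < \<delta>}"

definition tubular_map :: "(real \<Rightarrow> real^2) \<Rightarrow> real \<times> real \<Rightarrow> real^2" where
  "tubular_map \<gamma> = (\<lambda>(n, s). \<gamma> s + n *\<^sub>R normal \<gamma> s)"

definition C1_map_on ::
  "('a::real_normed_vector \<Rightarrow> 'b::real_normed_vector) \<Rightarrow> 'a set \<Rightarrow> bool" where
  "C1_map_on f U \<longleftrightarrow>
     (\<exists>f'. (\<forall>x\<in>U. (f has_derivative blinfun_apply (f' x)) (at x)) \<and> continuous_on U f')"

definition C1_diffeo_on ::
  "('a::real_normed_vector \<Rightarrow> 'b::real_normed_vector) \<Rightarrow> 'a set \<Rightarrow> bool" where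
  "C1_diffeo_on f U \<longleftrightarrow>
     open U \<and> open (f ` U) \<and> inj_on f U \<and> C1_map_on f U \<and> C1_map_on (the_inv_into U f) (f ` U)"

(* The tubular map is a diffeomorphism from (0,delta) x R/LZ onto the tube: it is a bijection
   for s in the fundamental domain [0,L), and it is a diffeomorphism near every point of the
   universal cover (0,delta) x R.  For a C2 curve the normal field is only C1, so C1 is the
   smoothness class in which such a diffeomorphism can be asked for. *)
definition tubular_coordinates ::
  "(real^2) set \<Rightarrow> (real^2) set \<Rightarrow> (real \<Rightarrow> real^2) \<Rightarrow> real \<Rightarrow> real \<Rightarrow> bool" where
  "tubular_coordinates \<Omega> C \<gamma> L \<delta> \<longleftrightarrow>
     bij_betw (tubular_map \<gamma>) ({0<..<\<delta>} \<times> {0..<L}) (tube \<Omega> C \<delta>) \<and>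
     (\<forall>x \<in> {0<..<\<delta>} \<times> UNIV. \<exists>W. x \<in> W \<and> W \<subseteq> {0<..<\<delta>} \<times> UNIV \<and>
        C1_diffeo_on (tubular_map \<gamma>) W)"

definition tubular_field ::
  "(real^2 \<Rightarrow> real) \<Rightarrow> (real \<Rightarrow> real^2) \<Rightarrow> (real \<Rightarrow> real) \<Rightarrow> real \<Rightarrow> real \<Rightarrow> real" where
  "tubular_field b \<gamma> \<kappa> n s = - b (tubular_map \<gamma> (n, s)) * (1 - n * \<kappa> s)"

(* v is the velocity of q; at the end points of [0,T] derivatives are one-sided. *)
definition trajectory ::
  "(real^2) set \<Rightarrow> (real^2 \<Rightarrow> real) \<Rightarrow> real \<Rightarrow> (real \<Rightarrow> real^2) \<Rightarrow> (real \<Rightarrow> real^2) \<Rightarrow> bool" where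
  "trajectory \<Omega> b T q v \<longleftrightarrow>
     (\<forall>t\<in>{0..T}. q t \<in> \<Omega> \<and>
        (q has_vector_derivative v t) (at t within {0..T}) \<and>
        (v has_vector_derivative b (q t) *\<^sub>R vector [v t $ 2, - (v t $ 1)]) (at t within {0..T}))"

definition flux :: "(real \<Rightarrow> real \<Rightarrow> real) \<Rightarrow> real \<Rightarrow> real \<Rightarrow> real \<Rightarrow> real" where
  "flux B L \<delta> n = - (1 / L) * integral {n..\<delta>} (\<lambda>\<eta>. integral {0..L} (\<lambda>\<xi>. B \<eta> \<xi>))"

(* n0, s0, sdot0 are the initial values of n, s and of the derivative of s; k0 = kappa (s0).
   In tubular coordinates Newton's equation gives, with p = sdot * (1 - n * kappa s)^2,
   pdot = - B * ndot - n * kappa' s * (1 - n * kappa s) * sdot^2, and the flux f satisfies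
   f' = mean of B.  The first summand is therefore |p + f n| at time 0.
   The source prints it as |sdot0 * (1 - k0 * n0) + (double integral)|, without the square,
   with the opposite sign and without 1/L; with that constant the confinement bound
   fails, for instance in small discs with a rotation-invariant field. *)
definition escape_const ::
  "(real \<Rightarrow> real \<Rightarrow> real) \<Rightarrow> real \<Rightarrow> real \<Rightarrow> real \<Rightarrow> real \<Rightarrow> real \<Rightarrow>
   real \<Rightarrow> real \<Rightarrow> real \<Rightarrow> real \<Rightarrow> real \<Rightarrow> real" where
  "escape_const B L \<delta> \<epsilon> M K' H0 n0 k0 sdot0 T =
     \<bar>sdot0 * (1 - k0 * n0)\<^sup>2
        - (1 / L) * integral {n0..\<delta>} (\<lambda>\<eta>. integral {0..L} (\<lambda>\<xi>. B \<eta> \<xi>))\<bar>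
     + sqrt (2 * H0) * (1 + \<epsilon>)
     + (M * sqrt (2 * H0) + 2 * H0 * K' * \<delta> / (1 - \<epsilon>)) * T"

(* The lower limit may be infinite, hence ereal; for the same reason g lives on (0,delta],
   its value at 0 being the prescribed limit. *)
definition minorant :: "(real \<Rightarrow> real) \<Rightarrow> real \<Rightarrow> (real \<Rightarrow> real) \<Rightarrow> bool" where
  "minorant f \<delta> g \<longleftrightarrow>
     continuous_on {0<..\<delta>} g \<and> strict_antimono_on {0<..\<delta>} g \<and>
     ((\<lambda>n. ereal (g n)) \<longlongrightarrow> Liminf (at_right 0) (\<lambda>n. ereal \<bar>f n\<bar>)) (at_right 0) \<and>
     (\<forall>n\<in>{0<..\<delta>}. g n \<le> \<bar>f n\<bar>)"

end

theory Submission
  imports Defs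
begin

text \<open>
  The quantity p = (v . tangent) (1 - n kappa) is the momentum conjugate to s. Newton's equation
  gives p' = - B n' - n kappa' s' (v . tangent), while the flux f satisfies f' = mean of B. Hence
  p + f(n) would be conserved for a rotation-invariant field, and in general drifts at a rate at
  most M sqrt(2 H0) + 2 H0 K' delta / (1 - epsilon). Since |p| < sqrt(2 H0) (1 + epsilon) by
  energy conservation, |f(n(t))| stays below the constant C(T), whereas g \<le> |f| exceeds it near
  the boundary.
\<close>

section \<open>Existence of minorants and their level crossings\<close>

lemma antimono_imp_integrable_on:
  fixes m :: "real \<Rightarrow> real"
  assumes "antimono_on {a..b} m"
  shows "m integrable_on {a..b}"
proof -
  have "mono_on {a..b} (\<lambda>x. - m x)"
    using assms by (auto simp: monotone_on_def)
  then show ?thesis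
    using integrable_neg[OF integrable_on_mono_on] by fastforce
qed

text \<open>Averaging over [x, 2x] makes a monotone function continuous without changing its limit at 0.\<close>

lemma antimono_average:
  fixes m :: "real \<Rightarrow> real"
  assumes m: "antimono_on {0<..} m"
  defines "G \<equiv> \<lambda>x. integral {x..2 * x} m / x"
  shows "continuous_on {0<..} G"
    and "0 < x \<Longrightarrow> x \<le> y \<Longrightarrow> G y \<le> G x"
    and "0 < x \<Longrightarrow> m (2 * x) \<le> G x"
    and "0 < x \<Longrightarrow> G x \<le> m x"
proof -
  have int: "m integrable_on {a..b}" if "0 < a" for a b
    by (rule antimono_imp_integrable_on) (rule monotone_on_subset[OF m], use that in auto)
  \<comment> \<open>The substitution \<open>u \<mapsto> x * u\<close> turns \<open>G x\<close> into
    an integral over the fixed interval \<open>{1..2}\<close>, so all three comparisons below reduce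
    to pointwise ones.\<close>
  have scaled: "((\<lambda>u. m (x * u)) has_integral G x) {1..2}" if "0 < x" for x
  proof -
    have "(\<lambda>u. u / x) ` {x..2 * x} = {1..2}"
      using image_divide_atLeastAtMost[OF that, of x "2 * x"] that by simp
    then show ?thesis
      using has_integral_stretch_real[OF integrable_integral[OF int[OF that, of "2 * x"]], of x] that
      by (simp add: G_def)
  qed
  have le: "m b \<le> m a" if "0 < a" "a \<le> b" for a b
    using m that by (auto simp: monotone_on_def)
  show "G y \<le> G x" if "0 < x" "x \<le> y" for x y
    by (rule has_integral_le[OF scaled scaled]) (use that in \<open>auto simp: le mult_right_mono\<close>)
  show "m (2 * x) \<le> G x" if "0 < x" for x
    using has_integral_le[OF has_integral_const_real[of "m (2 * x)" 1 2] scaled[OF that]] that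
    by (auto simp: le)
  show "G x \<le> m x" if "0 < x" for x
    using has_integral_le[OF scaled[OF that] has_integral_const_real[of "m x" 1 2]] that
    by (auto simp: le)
  show "continuous_on {0<..} G"
    unfolding continuous_on_eq_continuous_at[OF open_greaterThan]
  proof
    fix x :: real assume "x \<in> {0<..}"
    then have x: "0 < x" by simp
    \<comment> \<open>\<open>m\<close> may blow up at 0, so no base point serves all of
      \<open>{0<..}\<close>. The base point \<open>x / 2\<close> serves the window
      \<open>{x / 2<..<2 * x}\<close>, on which \<open>2 * y\<close> stays below
      \<open>4 * x\<close>.\<close>
    define F where "F = (\<lambda>y. integral {x / 2..y} m)"
    have F: "continuous_on {x / 2<..<4 * x} F"
      using indefinite_integral_continuous_1[OF int, of "x / 2" "4 * x"] x
      unfolding F_def by (auto elim: continuous_on_subset)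
    have "continuous_on {x / 2<..<2 * x} (\<lambda>y. (F (2 * y) - F y) / y)"
      by (intro continuous_intros continuous_on_compose2[OF F]) (use x in auto)
    moreover have "(F (2 * y) - F y) / y = G y" if "y \<in> {x / 2<..<2 * x}" for y
    proof -
      have "F y + integral {y..2 * y} m = F (2 * y)"
        unfolding F_def
        by (rule Henstock_Kurzweil_Integration.integral_combine) (use that x in \<open>auto intro: int\<close>)
      then show ?thesis
        by (simp add: G_def)
    qed
    ultimately have "continuous_on {x / 2<..<2 * x} G"
      by (rule continuous_on_eq)
    then show "isCont G x"
      using x by (auto simp: continuous_on_eq_continuous_at)
  qed
qed

text \<open>The infimum of |f| over (0, x] is decreasing in \<open>x\<close>, lies below |f| and
  tends to the lower limit at 0. Averaging over [x, 2x] makes it continuous, and subtracting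
  \<open>x\<close> makes it strictly decreasing; neither changes the limit, be it finite or
  infinite.\<close>

lemma exists_minorant:
  fixes f :: "real \<Rightarrow> real"
  assumes "0 < \<delta>"
  shows "\<exists>g. minorant f \<delta> g"
proof -
  \<comment> \<open>Truncation at \<open>\<delta>\<close> extends the infimum to all positive
    \<open>x\<close>, as needed because [x, 2x] may leave (0, \<delta>].\<close>
  define m where "m x = (INF y\<in>{0<..min x \<delta>}. \<bar>f y\<bar>)" for x
  have bdd: "bdd_below ((\<lambda>y. \<bar>f y\<bar>) ` A)" for A
    by (rule bdd_belowI[of _ 0]) auto
  have m_le: "m x \<le> \<bar>f y\<bar>" if "0 < y" "y \<le> x" "y \<le> \<delta>" for x y
    unfolding m_def by (rule cINF_lower[OF bdd]) (use that in auto)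
  have m_ge: "c \<le> m x" if "0 < x" "\<And>y. 0 < y \<Longrightarrow> y \<le> x \<Longrightarrow> c \<le> \<bar>f y\<bar>" for c x
    unfolding m_def by (rule cINF_greatest) (use that assms in auto)
  have "antimono_on {0<..} m"
  proof (rule monotone_onI)
    fix x y :: real assume "x \<in> {0<..}" "y \<in> {0<..}" "x \<le> y"
    then show "m y \<le> m x"
      unfolding m_def by (intro cINF_superset_mono[OF _ bdd]) (use assms in auto)
  qed
  note avg = antimono_average[OF this]
  define G where "G x = integral {x..2 * x} m / x" for x
  define g where "g x = G x - x" for x
  let ?l = "Liminf (at_right 0) (\<lambda>n. ereal \<bar>f n\<bar>)"
  have "((\<lambda>n. ereal (g n)) \<longlongrightarrow> ?l) (at_right 0)"
  proof (rule order_tendstoI)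
    fix a assume "a < ?l"
    then obtain c where c: "a < ereal c" "ereal c < ?l"
      using ereal_dense2 by blast
    \<comment> \<open>The gap between \<open>c\<close> and \<open>c'\<close> absorbs the subtracted
      \<open>x\<close>.\<close>
    then obtain c' where c': "ereal c < ereal c'" "ereal c' < ?l"
      using ereal_dense2 by blast
    have "eventually (\<lambda>n. ereal c' < ereal \<bar>f n\<bar>) (at_right 0)"
      by (rule less_LiminfD[OF c'(2)])
    then obtain d where d: "0 < d" "\<And>y. 0 < y \<Longrightarrow> y < d \<Longrightarrow> c' < \<bar>f y\<bar>"
      by (auto simp: eventually_at_right_field)
    \<comment> \<open>The bound \<open>d / 2\<close> is due to the average being controlled from
      below by \<open>m (2 * x)\<close>.\<close>
    have "eventually (\<lambda>x. x \<in> {0<..<min (d / 2) (c' - c)}) (at_right 0)"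
      by (rule eventually_at_right_real) (use d c' in auto)
    then show "eventually (\<lambda>n. a < ereal (g n)) (at_right 0)"
    proof eventually_elim
      case (elim x)
      have "c' \<le> m (2 * x)"
        by (rule m_ge) (use elim d(2) in \<open>auto intro!: less_imp_le\<close>)
      also have "\<dots> \<le> G x"
        unfolding G_def by (rule avg(3)) (use elim in auto)
      finally have "c < g x"
        using elim by (simp add: g_def)
      then show ?case
        using less_trans[OF c(1), of "ereal (g x)"] by simp
    qed
  next
    fix a assume a: "?l < a"
    have "eventually (\<lambda>x. x \<in> {0<..<\<delta>}) (at_right 0)"
      by (rule eventually_at_right_real) (use assms in auto)
    then show "eventually (\<lambda>n. ereal (g n) < a) (at_right 0)"
    proof eventually_elim
      case (elim x)
      have "eventually (\<lambda>y. y \<in> {0<..<x}) (at_right 0)"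
        by (rule eventually_at_right_real) (use elim in auto)
      \<comment> \<open>Every \<open>y\<close> below \<open>x\<close> satisfies
        \<open>m x \<le> \<bar>f y\<bar>\<close>, so the upper estimate
        \<open>g x \<le> m x \<le> ?l\<close> holds for each small \<open>x\<close>, not only in the
        limit.\<close>
      then have "ereal (m x) \<le> ?l"
        by (intro Liminf_bounded) (rule eventually_mono, assumption, use elim in \<open>auto intro!: m_le\<close>)
      moreover have "g x \<le> m x"
        using avg(4)[of x] elim by (simp add: g_def G_def)
      ultimately have "ereal (g x) \<le> ?l"
        using order_trans[of "ereal (g x)" "ereal (m x)" ?l] by simp
      then show ?case
        using a by (rule le_less_trans)
    qed
  qed
  moreover have "continuous_on {0<..\<delta>} g"
    unfolding g_def G_def
    by (intro continuous_intros continuous_on_subset[OF avg(1)]) auto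
  moreover have "strict_antimono_on {0<..\<delta>} g"
  proof (rule monotone_onI)
    fix x y :: real assume "x \<in> {0<..\<delta>}" "y \<in> {0<..\<delta>}" "x < y"
    then show "g y < g x"
      using avg(2)[of x y] by (simp add: g_def G_def)
  qed
  moreover have "g x \<le> \<bar>f x\<bar>" if "x \<in> {0<..\<delta>}" for x
    using avg(4)[of x] m_le[of x x] that by (simp add: g_def G_def)
  ultimately show ?thesis
    unfolding minorant_def by blast
qed

text \<open>Near 0 the function \<open>g\<close> exceeds \<open>c\<close> because its limit does,
  and at \<open>x0\<close> it is below \<open>c\<close> because g \<le> |f|; the intermediate value
  theorem gives the crossing. Wherever |f| < c also g < c, and strict decrease puts such points to
  the right of the crossing.\<close>

lemma minorant_crossing:
  assumes g: "minorant f \<delta> g"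
    and lim: "ereal c < Liminf (at_right 0) (\<lambda>n. ereal \<bar>f n\<bar>)"
    and x0: "x0 \<in> {0<..\<delta>}" "\<bar>f x0\<bar> < c"
  shows "c \<in> g ` {0<..\<delta>}"
    and "x \<in> {0<..\<delta>} \<Longrightarrow> \<bar>f x\<bar> < c \<Longrightarrow> the_inv_into {0<..\<delta>} g c < x"
proof -
  have anti: "g y < g x" if "x \<in> {0<..\<delta>}" "y \<in> {0<..\<delta>}" "x < y" for x y
    using g that by (auto simp: minorant_def monotone_on_def)
  have le: "g x \<le> \<bar>f x\<bar>" if "x \<in> {0<..\<delta>}" for x
    using g that by (auto simp: minorant_def)
  have "eventually (\<lambda>n. ereal c < ereal (g n)) (at_right 0)"
    using g lim order_tendstoD(1) unfolding minorant_def by blast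
  moreover have "eventually (\<lambda>n. n \<in> {0<..<x0}) (at_right 0)"
    by (rule eventually_at_right_real) (use x0 in auto)
  ultimately have "eventually (\<lambda>n. c < g n \<and> n \<in> {0<..<x0}) (at_right 0)"
    by eventually_elim auto
  then obtain a where a: "c < g a" "0 < a" "a < x0"
    using eventually_happens' trivial_limit_at_right_real by fastforce
  have "continuous_on {a..x0} g"
    using g a x0 unfolding minorant_def by (auto elim!: continuous_on_subset)
  then obtain z where z: "z \<in> {a..x0}" "g z = c"
    using IVT2'[of g x0 c a] le[OF x0(1)] x0 a by fastforce
  then have z': "z \<in> {0<..\<delta>}"
    using a x0 by auto
  then show "c \<in> g ` {0<..\<delta>}"
    using z by blast
  have "inj_on g {0<..\<delta>}"
    using anti by (metis inj_onI linorder_neqE less_irrefl)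
  then have inv: "the_inv_into {0<..\<delta>} g c = z"
    using z' z by (simp add: the_inv_into_f_eq)
  show "the_inv_into {0<..\<delta>} g c < x" if x: "x \<in> {0<..\<delta>}" "\<bar>f x\<bar> < c"
    using anti[OF x(1) z'] le[OF x(1)] x(2) z(2) inv by (cases x z rule: linorder_cases) auto
qed

section \<open>The moving frame of the boundary curve\<close>

text \<open>The same rotation produces the normal from the tangent and, up to the factor
  \<open>- b\<close>, the magnetic force from the velocity.\<close>

definition rot90 :: "real^2 \<Rightarrow> real^2" where
  "rot90 x = vector [- (x $ 2), x $ 1]"

lemma normal_eq: "normal \<gamma> s = rot90 (tangent \<gamma> s)"
  by (simp add: normal_def rot90_def)

lemma rot90_rot90 [simp]: "rot90 (rot90 x) = - x"
  by (simp add: rot90_def vec_eq_iff forall_2)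

lemma rot90_scaleR: "rot90 (c *\<^sub>R x) = c *\<^sub>R rot90 x"
  by (simp add: rot90_def vec_eq_iff forall_2)

lemma inner_rot90_left: "rot90 x \<bullet> y = - (x \<bullet> rot90 y)"
  by (simp add: rot90_def inner_vec_def sum_2)

lemma inner_rot90_self [simp]: "x \<bullet> rot90 x = 0"
  by (simp add: rot90_def inner_vec_def sum_2)

lemma norm_rot90 [simp]: "norm (rot90 x) = norm x"
  by (simp add: rot90_def norm_eq_sqrt_inner inner_vec_def sum_2)

lemma bounded_linear_rot90: "bounded_linear rot90"
  unfolding rot90_def
  by (intro linear_conv_bounded_linear[THEN iffD1] linearI) (auto simp: vec_eq_iff forall_2)

text \<open>These are the Frenet equations. The third follows from the second by applying the linear
  map \<open>rot90\<close>, whose square is minus the identity.\<close>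

lemma arclength_has_derivatives:
  assumes param: "arclength_param \<gamma> L C"
    and curvature: "\<And>s. vector_derivative (tangent \<gamma>) (at s) = \<kappa> s *\<^sub>R normal \<gamma> s"
  shows "(\<gamma> has_vector_derivative tangent \<gamma> s) (at s)"
    and "(tangent \<gamma> has_vector_derivative \<kappa> s *\<^sub>R normal \<gamma> s) (at s)"
    and "(normal \<gamma> has_vector_derivative - \<kappa> s *\<^sub>R tangent \<gamma> s) (at s)"
proof -
  show "(\<gamma> has_vector_derivative tangent \<gamma> s) (at s)"
    using param unfolding arclength_param_def C1_differentiable_on_eq tangent_def
    by (simp add: vector_derivative_works)
  show *: "(tangent \<gamma> has_vector_derivative \<kappa> s *\<^sub>R normal \<gamma> s) (at s)"
    using param vector_derivative_works[of "tangent \<gamma>" "at s"]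
    unfolding arclength_param_def C1_differentiable_on_eq by (simp add: curvature)
  have "((\<lambda>s. rot90 (tangent \<gamma> s)) has_vector_derivative rot90 (\<kappa> s *\<^sub>R normal \<gamma> s)) (at s)"
    by (rule bounded_linear.has_vector_derivative[OF bounded_linear_rot90 *])
  then show "(normal \<gamma> has_vector_derivative - \<kappa> s *\<^sub>R tangent \<gamma> s) (at s)"
    by (simp add: normal_eq[abs_def] rot90_scaleR)
qed

lemma vector_derivative_periodic:
  fixes h :: "real \<Rightarrow> 'a::real_normed_vector"
  assumes "\<And>x. h differentiable (at x)" "\<And>x. h (x + L) = h x"
  shows "vector_derivative h (at (x + L)) = vector_derivative h (at x)"
proof -
  have "((h \<circ> (\<lambda>x. x + L)) has_vector_derivative 1 *\<^sub>R vector_derivative h (at (x + L))) (at x)"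
    by (intro vector_diff_chain_at) (auto intro!: derivative_eq_intros simp: assms vector_derivative_works[symmetric])
  moreover have "h \<circ> (\<lambda>x. x + L) = h"
    using assms(2) by auto
  ultimately show ?thesis
    by (simp add: vector_derivative_at)
qed

text \<open>Every value is already attained on the compact interval \<open>{0..L}\<close>.
  Boundedness makes the real supremum \<open>K\<close> of the absolute curvature a genuine upper
  bound.\<close>

lemma periodic_continuous_bounded:
  fixes h :: "real \<Rightarrow> real"
  assumes "0 < L" "\<And>x. h (x + L) = h x" "continuous_on UNIV h"
  shows "bdd_above (range (\<lambda>x. \<bar>h x\<bar>))"
proof -
  have shift: "h (x + of_int k * L) = h x" for x k
  proof (induction k rule: int_induct[where k = 0])
    case (step1 i)
    then show ?case
      using assms(2)[of "x + of_int i * L"] by (simp add: algebra_simps)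
  next
    case (step2 i)
    then show ?case
      using assms(2)[of "x + of_int (i - 1) * L"] by (simp add: algebra_simps)
  qed simp
  have "compact ((\<lambda>x. \<bar>h x\<bar>) ` {0..L})"
    by (intro compact_continuous_image continuous_on_rabs continuous_on_subset[OF assms(3)]) auto
  then have "bdd_above ((\<lambda>x. \<bar>h x\<bar>) ` {0..L})"
    by (intro bounded_imp_bdd_above compact_imp_bounded)
  moreover have "range (\<lambda>x. \<bar>h x\<bar>) \<subseteq> (\<lambda>x. \<bar>h x\<bar>) ` {0..L}"
  proof safe
    fix x
    have "x + of_int (- \<lfloor>x / L\<rfloor>) * L \<in> {0..L}"
      using assms(1) floor_divide_lower[of L x] floor_divide_upper[of L x] by (auto simp: algebra_simps)
    then show "\<bar>h x\<bar> \<in> (\<lambda>x. \<bar>h x\<bar>) ` {0..L}"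
      using shift[of x "- \<lfloor>x / L\<rfloor>"] by (metis image_eqI)
  qed
  ultimately show ?thesis
    by (rule bdd_above_mono)
qed

text \<open>Periodicity passes from \<gamma> to its derivatives. For \<kappa> it remains to cancel
  the normal, which is a unit vector and hence nonzero.\<close>

lemma arclength_periodic:
  assumes param: "arclength_param \<gamma> L C"
    and curvature: "\<And>s. vector_derivative (tangent \<gamma>) (at s) = \<kappa> s *\<^sub>R normal \<gamma> s"
  shows "tangent \<gamma> (s + L) = tangent \<gamma> s" "normal \<gamma> (s + L) = normal \<gamma> s" "\<kappa> (s + L) = \<kappa> s"
proof -
  note deriv = arclength_has_derivatives[OF param curvature]
  have period: "\<gamma> (s + L) = \<gamma> s" for s
    using param by (simp add: arclength_param_def)
  have tangent: "tangent \<gamma> (s + L) = tangent \<gamma> s" for s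
    unfolding tangent_def
    by (rule vector_derivative_periodic) (auto intro: period differentiableI_vector[OF deriv(1)])
  show "tangent \<gamma> (s + L) = tangent \<gamma> s"
    by (rule tangent)
  show normal: "normal \<gamma> (s + L) = normal \<gamma> s"
    by (simp add: normal_eq tangent)
  have "vector_derivative (tangent \<gamma>) (at (s + L)) = vector_derivative (tangent \<gamma>) (at s)"
    by (rule vector_derivative_periodic) (auto intro: tangent differentiableI_vector[OF deriv(2)])
  moreover have "norm (normal \<gamma> s) = 1"
    using param by (simp add: normal_eq arclength_param_def)
  ultimately show "\<kappa> (s + L) = \<kappa> s"
    by (auto simp: curvature normal)
qed

section \<open>Differentiability of the coordinates and equations of motion\<close>

text \<open>Continuity keeps \<open>x\<close> inside \<open>W\<close> near \<open>t\<close>, so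
  there \<open>x\<close> is the local inverse of \<psi> composed with \<open>q\<close>, and the
  chain rule applies.\<close>

lemma C1_diffeo_lift_has_derivative:
  fixes q :: "real \<Rightarrow> 'b::real_normed_vector"
  assumes diffeo: "C1_diffeo_on \<psi> W"
    and t: "t \<in> S" "x t \<in> W"
    and x: "continuous (at t within S) x"
    and q: "\<And>r. r \<in> S \<Longrightarrow> q r = \<psi> (x r)" "(q has_vector_derivative v) (at t within S)"
  shows "\<exists>w. (x has_vector_derivative w) (at t within S)"
proof -
  let ?\<phi> = "the_inv_into W \<psi>"
  have W: "open W" "inj_on \<psi> W"
    using diffeo by (auto simp: C1_diffeo_on_def)
  have "\<psi> (x t) \<in> \<psi> ` W"
    using t by blast
  then obtain D where "(?\<phi> has_derivative D) (at (q t))"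
    using diffeo q(1)[OF t(1)] unfolding C1_diffeo_on_def C1_map_on_def by metis
  then have "((?\<phi> \<circ> q) has_vector_derivative D v) (at t within S)"
    by (intro vector_derivative_diff_chain_within[OF q(2)]) (rule has_derivative_at_withinI)
  moreover have "eventually (\<lambda>r. (?\<phi> \<circ> q) r = x r) (at t within S)"
  proof -
    have "eventually (\<lambda>r. x r \<in> W) (at t within S)"
      using x W(1) t(2) unfolding continuous_within by (rule topological_tendstoD)
    moreover have "eventually (\<lambda>r. r \<in> S) (at t within S)"
      by (simp add: eventually_at_filter)
    ultimately show ?thesis
      by eventually_elim (simp add: q(1) the_inv_into_f_f[OF W(2)])
  qed
  moreover have "(?\<phi> \<circ> q) t = x t"
    using t by (simp add: q(1) the_inv_into_f_f[OF W(2)])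
  ultimately have "(x has_vector_derivative D v) (at t within S)"
    unfolding has_vector_derivative_def by (rule has_derivative_transform_eventually[OF _ _ _ t(1)])
  then show ?thesis ..
qed

text \<open>The coordinates of a trajectory are given as continuous functions, with \<open>s\<close>
  in the universal cover of the circle; a local inverse of the tubular map makes them
  differentiable.\<close>

lemma tubular_coordinates_differentiable:
  assumes coordinates: "tubular_coordinates \<Omega> C \<gamma> L \<delta>"
    and coords: "continuous_on S n" "continuous_on S s"
      "\<And>t. t \<in> S \<Longrightarrow> n t \<in> {0<..<\<delta>}"
      "\<And>t. t \<in> S \<Longrightarrow> q t = tubular_map \<gamma> (n t, s t)"
    and q: "(q has_vector_derivative v) (at t within S)" and t: "t \<in> S"
  obtains n' s' where "(n has_real_derivative n') (at t within S)"
    "(s has_real_derivative s') (at t within S)"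
proof -
  have "(n t, s t) \<in> {0<..<\<delta>} \<times> UNIV"
    using coords(3)[OF t] by simp
  then obtain W where W: "(n t, s t) \<in> W" "C1_diffeo_on (tubular_map \<gamma>) W"
    using coordinates unfolding tubular_coordinates_def by blast
  have "continuous (at t within S) (\<lambda>t. (n t, s t))"
    using coords(1,2) t by (auto simp: continuous_on_eq_continuous_within intro: continuous_Pair)
  then obtain w where w: "((\<lambda>t. (n t, s t)) has_vector_derivative w) (at t within S)"
    using C1_diffeo_lift_has_derivative[OF W(2) t _ _ _ q, of "\<lambda>t. (n t, s t)"] W(1) coords(4) by blast
  have "(n has_vector_derivative fst w) (at t within S)"
    using bounded_linear.has_vector_derivative[OF bounded_linear_fst w] by simp
  moreover have "(s has_vector_derivative snd w) (at t within S)"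
    using bounded_linear.has_vector_derivative[OF bounded_linear_snd w] by simp
  ultimately show ?thesis
    using that by (simp add: has_real_derivative_iff_has_vector_derivative)
qed

lemma has_vector_derivative_compose_real:
  assumes "(f has_vector_derivative f') (at (g t))" "(g has_real_derivative g') (at t within S)"
  shows "((\<lambda>t. f (g t)) has_vector_derivative g' *\<^sub>R f') (at t within S)"
  using vector_diff_chain_within[of g g' t S f f'] assms
  by (simp add: has_real_derivative_iff_has_vector_derivative o_def has_vector_derivative_at_within)

text \<open>By the Frenet equations the partial derivatives of the tubular map are the normal in
  \<open>n\<close> and (1 - n \<kappa>) times the tangent in \<open>s\<close>.\<close>

lemma tubular_velocity:
  assumes param: "arclength_param \<gamma> L C"
    and curvature: "\<And>s. vector_derivative (tangent \<gamma>) (at s) = \<kappa> s *\<^sub>R normal \<gamma> s"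
    and n: "(n has_real_derivative n') (at t within S)"
    and s: "(s has_real_derivative s') (at t within S)"
  shows "((\<lambda>t. tubular_map \<gamma> (n t, s t)) has_vector_derivative
    n' *\<^sub>R normal \<gamma> (s t) + (s' * (1 - n t * \<kappa> (s t))) *\<^sub>R tangent \<gamma> (s t)) (at t within S)"
proof -
  note deriv = arclength_has_derivatives[OF param curvature]
  show ?thesis
    unfolding tubular_map_def split_conv
    by (rule has_vector_derivative_eq_rhs,
        rule has_vector_derivative_add[OF has_vector_derivative_compose_real[OF deriv(1) s]
          has_vector_derivative_scaleR[OF n has_vector_derivative_compose_real[OF deriv(3) s]]])
      (simp add: algebra_simps)
qed

text \<open>The turning of the tangent contributes \<open>s' * \<kappa> * n'\<close> times the
  factor 1 - n \<kappa>, and the derivative of that factor contributes the same amount with the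
  opposite sign. What remains is the magnetic term and the term in \<kappa>'.\<close>

lemma tangential_momentum_has_derivative:
  assumes param: "arclength_param \<gamma> L C"
    and curvature: "\<And>s. vector_derivative (tangent \<gamma>) (at s) = \<kappa> s *\<^sub>R normal \<gamma> s"
    and \<kappa>: "\<kappa> differentiable (at (s t))"
    and n: "(n has_real_derivative n') (at t within S)"
    and s: "(s has_real_derivative s') (at t within S)"
    and v: "(v has_vector_derivative b (tubular_map \<gamma> (n t, s t)) *\<^sub>R vector [v t $ 2, - (v t $ 1)])
      (at t within S)"
    and u: "v t \<bullet> tangent \<gamma> (s t) = s' * (1 - n t * \<kappa> (s t))" "v t \<bullet> normal \<gamma> (s t) = n'"
  shows "((\<lambda>t. (v t \<bullet> tangent \<gamma> (s t)) * (1 - n t * \<kappa> (s t))) has_real_derivative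
    - tubular_field b \<gamma> \<kappa> (n t) (s t) * n'
      - n t * deriv \<kappa> (s t) * s' * (v t \<bullet> tangent \<gamma> (s t))) (at t within S)"
proof -
  note deriv = arclength_has_derivatives[OF param curvature]
  have "vector [v t $ 2, - (v t $ 1)] = - rot90 (v t)"
    by (simp add: rot90_def vec_eq_iff forall_2)
  then have "((\<lambda>t. v t \<bullet> tangent \<gamma> (s t)) has_vector_derivative
      v t \<bullet> (s' *\<^sub>R \<kappa> (s t) *\<^sub>R normal \<gamma> (s t)) +
      (b (tubular_map \<gamma> (n t, s t)) *\<^sub>R - rot90 (v t)) \<bullet> tangent \<gamma> (s t)) (at t within S)"
    using bounded_bilinear.has_vector_derivative[OF bounded_bilinear_inner v
      has_vector_derivative_compose_real[OF deriv(2) s]] by simp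
  then have u': "((\<lambda>t. v t \<bullet> tangent \<gamma> (s t)) has_real_derivative
      s' * \<kappa> (s t) * n' + b (tubular_map \<gamma> (n t, s t)) * n') (at t within S)"
    by (simp add: has_real_derivative_iff_has_vector_derivative inner_rot90_left u normal_eq[symmetric])
  have "DERIV \<kappa> (s t) :> deriv \<kappa> (s t)"
    using \<kappa> by (simp add: DERIV_deriv_iff_real_differentiable)
  then have w': "((\<lambda>t. 1 - n t * \<kappa> (s t)) has_real_derivative
      - (n' * \<kappa> (s t) + n t * (deriv \<kappa> (s t) * s'))) (at t within S)"
    using n DERIV_chain2[OF _ s] by (auto intro!: derivative_eq_intros)
  show ?thesis
    by (rule DERIV_cong[OF DERIV_mult[OF u' w']]) (simp add: u(1) tubular_field_def algebra_simps)
qed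

text \<open>The force is orthogonal to the velocity, so the derivative of
  \<open>v t \<bullet> v t\<close> vanishes.\<close>

lemma magnetic_speed_constant:
  fixes v :: "real \<Rightarrow> real^2"
  assumes "\<And>t. t \<in> {a..b} \<Longrightarrow>
    (v has_vector_derivative c t *\<^sub>R vector [v t $ 2, - (v t $ 1)]) (at t within {a..b})"
    and "t \<in> {a..b}"
  shows "norm (v t) = norm (v a)"
proof -
  have "((\<lambda>t. v t \<bullet> v t) has_real_derivative 0) (at t within {a..b})" if "t \<in> {a..b}" for t
    using bounded_bilinear.has_vector_derivative[OF bounded_bilinear_inner assms(1) assms(1), OF that that]
    by (simp add: has_real_derivative_iff_has_vector_derivative inner_vec_def sum_2 mult.commute)
  then have "\<exists>d. \<forall>t\<in>{a..b}. v t \<bullet> v t = d"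
    by (intro has_field_derivative_zero_constant) auto
  then have "v t \<bullet> v t = v a \<bullet> v a"
    using assms(2) by fastforce
  then show ?thesis
    by (simp add: norm_eq_sqrt_inner)
qed

section \<open>Regularity of the flux\<close>

text \<open>
  Nothing is known about integrability near the right end point, and a non-integrable function has
  integral 0. A single nonzero tail rules this out for every tail.
\<close>

lemma tail_integral_has_derivative:
  fixes \<beta> :: "real \<Rightarrow> real"
  assumes cont: "continuous_on {0<..<\<delta>} \<beta>"
    and c: "c \<in> {0<..<\<delta>}" "integral {c..\<delta>} \<beta> \<noteq> 0"
    and x: "x \<in> {0<..<\<delta>}"
  shows "((\<lambda>y. integral {y..\<delta>} \<beta>) has_real_derivative - \<beta> x) (at x)"
proof -
  \<comment> \<open>The base point \<open>a\<close> lies left of both \<open>x\<close> and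
    \<open>c\<close>: integrability on \<open>{a..\<delta>}\<close> comes from the tail at
    \<open>c\<close> and continuity on \<open>{a..c}\<close>. The point \<open>d\<close> keeps
    \<open>{a..d}\<close> away from \<delta>, where continuity is not given.\<close>
  define a where "a = min x c / 2"
  define d where "d = (x + \<delta>) / 2"
  have a: "0 < a" "a < x" "a < c" and d: "x < d" "d < \<delta>"
    using c x by (auto simp: a_def d_def min_def)
  have "\<beta> integrable_on {c..\<delta>}"
    using c(2) not_integrable_integral by blast
  moreover have "\<beta> integrable_on {a..c}"
    by (intro integrable_continuous_real continuous_on_subset[OF cont]) (use a c in auto)
  ultimately have int: "\<beta> integrable_on {a..\<delta>}"
    using a c by (intro Henstock_Kurzweil_Integration.integrable_combine[of a c \<delta>]) auto
  have "continuous_on {a..d} \<beta>"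
    by (rule continuous_on_subset[OF cont]) (use a d in auto)
  then have "((\<lambda>y. integral {a..y} \<beta>) has_real_derivative \<beta> x) (at x within {a..d})"
    by (rule integral_has_real_derivative) (use a d in auto)
  then have "((\<lambda>y. integral {a..y} \<beta>) has_real_derivative \<beta> x) (at x)"
    using a d by (simp add: at_within_Icc_at)
  then have "((\<lambda>y. integral {a..\<delta>} \<beta> - integral {a..y} \<beta>) has_real_derivative - \<beta> x) (at x)"
    by (auto intro!: derivative_eq_intros)
  then show ?thesis
  proof (rule has_field_derivative_transform_within_open[where S = "{a<..<\<delta>}"])
    fix y assume "y \<in> {a<..<\<delta>}"
    then show "integral {a..\<delta>} \<beta> - integral {a..y} \<beta> = integral {y..\<delta>} \<beta>"
      using Henstock_Kurzweil_Integration.integral_combine[OF _ _ int, of y] by auto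
  qed (use a x in auto)
qed

text \<open>Integrating over a period calls for the closed interval \<open>{0..L}\<close>, whereas
  the tubular coordinates cover \<open>{0..<L}\<close>. Periodicity identifies the end point
  \<open>L\<close> with 0, so \<open>b\<close> is only evaluated inside \<Omega>.\<close>

lemma continuous_on_tubular_field:
  assumes param: "arclength_param \<gamma> L C"
    and curvature: "\<And>s. vector_derivative (tangent \<gamma>) (at s) = \<kappa> s *\<^sub>R normal \<gamma> s"
    and \<kappa>: "continuous_on UNIV \<kappa>"
    and coordinates: "tubular_coordinates \<Omega> C \<gamma> L \<delta>"
    and b: "continuous_on \<Omega> b"
  shows "continuous_on ({0<..<\<delta>} \<times> {0..L}) (\<lambda>(\<eta>, \<xi>). tubular_field b \<gamma> \<kappa> \<eta> \<xi>)"
proof -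
  note deriv = arclength_has_derivatives[OF param curvature]
  have cont: "continuous_on UNIV \<gamma>" "continuous_on UNIV (normal \<gamma>)"
    using deriv(1,3) by (auto intro!: continuous_at_imp_continuous_on has_vector_derivative_continuous)
  have L: "0 < L" "\<gamma> L = \<gamma> 0" "normal \<gamma> L = normal \<gamma> 0"
    using param arclength_periodic(2)[OF param curvature, of 0]
    by (auto simp: arclength_param_def) (metis add_0)
  have mem: "tubular_map \<gamma> (\<eta>, \<xi>) \<in> \<Omega>" if "\<eta> \<in> {0<..<\<delta>}" "\<xi> \<in> {0..L}" for \<eta> \<xi>
  proof -
    define \<xi>' where "\<xi>' = (if \<xi> = L then 0 else \<xi>)"
    have "tubular_map \<gamma> (\<eta>, \<xi>) = tubular_map \<gamma> (\<eta>, \<xi>')" "\<xi>' \<in> {0..<L}"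
      using L that by (auto simp: tubular_map_def \<xi>'_def)
    moreover have "tubular_map \<gamma> ` ({0<..<\<delta>} \<times> {0..<L}) \<subseteq> \<Omega>"
      using coordinates by (auto simp: tubular_coordinates_def bij_betw_def tube_def)
    ultimately show ?thesis
      using that by auto
  qed
  have "continuous_on ({0<..<\<delta>} \<times> {0..L}) (tubular_map \<gamma>)"
    unfolding tubular_map_def case_prod_unfold
    by (intro continuous_intros continuous_on_compose2[OF cont(1)] continuous_on_compose2[OF cont(2)]) auto
  then show ?thesis
    unfolding tubular_field_def case_prod_unfold prod.collapse
    by (intro continuous_intros continuous_on_compose2[OF b] continuous_on_compose2[OF \<kappa>])
      (use mem in \<open>auto simp: image_subset_iff\<close>)
qed

section \<open>Confinement through the drift of \<open>p t + f (n t)\<close>\<close>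

theorem theorem2p2:
  fixes \<Omega> \<C> :: "(real^2) set" and b :: "real^2 \<Rightarrow> real"
    and \<gamma> q v :: "real \<Rightarrow> real^2" and \<kappa> n s :: "real \<Rightarrow> real"
    and L \<delta> \<epsilon> K K' M T H0 sdot0 CT :: real
    and B :: "real \<Rightarrow> real \<Rightarrow> real" and f :: "real \<Rightarrow> real"
  assumes domain: "smooth_bounded_domain \<Omega>"
    and b: "locally_lipschitz_field \<Omega> b"
    and component: "\<C> \<in> components (frontier \<Omega>)"
    and param: "arclength_param \<gamma> L \<C>"
    and inward: "inward_normal \<Omega> \<gamma>"
    and curvature: "\<And>s. vector_derivative (tangent \<gamma>) (at s) = \<kappa> s *\<^sub>R normal \<gamma> s"
    and curvature_deriv: "\<And>s. \<kappa> differentiable (at s)"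
      "bdd_above (range (\<lambda>s. \<bar>deriv \<kappa> s\<bar>))"
    and \<delta>_pos: "0 < \<delta>"
    and coordinates: "tubular_coordinates \<Omega> \<C> \<gamma> L \<delta>"
    and B: "B = tubular_field b \<gamma> \<kappa>"
    and K: "K = (SUP s. \<bar>\<kappa> s\<bar>)"
    and K': "K' = (SUP s. \<bar>deriv \<kappa> s\<bar>)"
    and \<epsilon>: "0 < \<epsilon>" "\<epsilon> < 1" "\<delta> \<le> \<epsilon> / K"
    and M: "0 \<le> M"
      "\<And>n s. n \<in> {0<..<\<delta>} \<Longrightarrow>
         \<bar>B n s - (1 / L) * integral {0..L} (\<lambda>\<xi>. B n \<xi>)\<bar> \<le> M"
    and T: "0 < T"
    and trajectory: "trajectory \<Omega> b T q v"
    and in_tube: "\<And>t. t \<in> {0..T} \<Longrightarrow> q t \<in> tube \<Omega> \<C> \<delta>"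
    and coords: "continuous_on {0..T} n" "continuous_on {0..T} s"
      "\<And>t. t \<in> {0..T} \<Longrightarrow> n t \<in> {0<..<\<delta>}"
      "\<And>t. t \<in> {0..T} \<Longrightarrow> q t = tubular_map \<gamma> (n t, s t)"
    and sdot0: "(s has_real_derivative sdot0) (at 0 within {0..T})"
    and energy: "H0 = (1/2) * (norm (v 0))\<^sup>2"
    and moving: "0 < H0"
    and f: "f = flux B L \<delta>"
    and CT: "CT = escape_const B L \<delta> \<epsilon> M K' H0 (n 0) (\<kappa> (s 0)) sdot0 T"
    and barrier: "Liminf (at_right 0) (\<lambda>n. ereal \<bar>f n\<bar>) > ereal CT"
  shows "(\<exists>g. minorant f \<delta> g) \<and>
         (\<forall>g. minorant f \<delta> g \<longrightarrow>
            CT \<in> g ` {0<..\<delta>} \<and>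
            (\<forall>t\<in>{0..<T}. n t > the_inv_into {0<..\<delta>} g CT))"
proof -
  note deriv = arclength_has_derivatives[OF param curvature]
  have L: "0 < L"
    using param by (simp add: arclength_param_def)
  have D\<kappa>: "DERIV \<kappa> x :> deriv \<kappa> x" for x
    using curvature_deriv(1) by (simp add: DERIV_deriv_iff_real_differentiable)
  have cont_\<kappa>: "continuous_on UNIV \<kappa>"
    by (intro continuous_at_imp_continuous_on ballI DERIV_isCont[OF D\<kappa>])
  have \<kappa>_le: "\<bar>\<kappa> x\<bar> \<le> K" for x
    unfolding K
    by (intro cSUP_upper periodic_continuous_bounded[OF L _ cont_\<kappa>]
        arclength_periodic(3)[OF param curvature]) auto
  have d\<kappa>_le: "\<bar>deriv \<kappa> x\<bar> \<le> K'" for x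
    unfolding K' by (intro cSUP_upper curvature_deriv(2)) auto
  have "0 \<le> K"
    using \<kappa>_le[of 0] by linarith
  \<comment> \<open>If \<open>K\<close> were 0, then \<open>\<epsilon> / K\<close> would be 0 by the
    convention for division by zero, contradicting \<open>0 < \<delta>\<close>.\<close>
  then have K_pos: "0 < K"
    using \<epsilon>(3) \<delta>_pos by (cases "K = 0") auto
  then have \<delta>K: "\<delta> * K \<le> \<epsilon>"
    using \<epsilon>(3) by (simp add: pos_le_divide_eq)
  have n\<kappa>: "\<bar>n t * \<kappa> x\<bar> < \<epsilon>" if "t \<in> {0..T}" for t x
  proof -
    have "\<bar>n t * \<kappa> x\<bar> \<le> n t * K"
      using coords(3)[OF that] \<kappa>_le[of x] by (simp add: abs_mult mult_left_mono)
    also have "\<dots> < \<delta> * K"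
      using coords(3)[OF that] K_pos by simp
    finally show ?thesis
      using \<delta>K by linarith
  qed

  define V where "V = sqrt (2 * H0)"
  have V: "0 < V" "V\<^sup>2 = 2 * H0"
    using moving by (auto simp: V_def)
  have q': "(q has_vector_derivative v t) (at t within {0..T})"
    and v': "(v has_vector_derivative b (q t) *\<^sub>R vector [v t $ 2, - (v t $ 1)]) (at t within {0..T})"
    if "t \<in> {0..T}" for t
    using trajectory that by (auto simp: trajectory_def)
  have speed: "norm (v t) = V" if "t \<in> {0..T}" for t
  proof -
    have "2 * H0 = (norm (v 0))\<^sup>2"
      using energy by simp
    then show ?thesis
      using magnetic_speed_constant[OF v' that] by (simp add: V_def)
  qed

  define I where "I \<eta> = integral {0..L} (\<lambda>\<xi>. B \<eta> \<xi>)" for \<eta>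
  \<comment> \<open>\<open>R\<close> bounds the drift rate: \<open>M * V\<close> accounts for the
    deviation of \<open>B\<close> from its mean, the other summand for the variation of the
    curvature.\<close>
  define R where "R = M * V + 2 * H0 * K' * \<delta> / (1 - \<epsilon>)"
  have K'_nonneg: "0 \<le> K'"
    using d\<kappa>_le[of 0] by linarith
  have R_nonneg: "0 \<le> R"
    using M(1) V K'_nonneg moving \<delta>_pos \<epsilon> by (auto simp: R_def)
  define p where "p t = (v t \<bullet> tangent \<gamma> (s t)) * (1 - n t * \<kappa> (s t))" for t
  \<comment> \<open>The normalised double integral in \<open>escape_const\<close>, with its minus
    sign, is exactly \<open>f (n 0)\<close>.\<close>
  have CT_eq: "CT = \<bar>sdot0 * (1 - \<kappa> (s 0) * n 0)\<^sup>2 + f (n 0)\<bar> + V * (1 + \<epsilon>) + R * T"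
    by (simp add: CT escape_const_def f flux_def V_def R_def)
  have "0 < V * (1 + \<epsilon>)"
    using V \<epsilon> by simp
  then have "0 < CT"
    using R_nonneg T CT_eq by (smt (verit) mult_nonneg_nonneg)
  \<comment> \<open>Near 0 the barrier forces |f| above the positive number \<open>CT\<close>. A
    point with nonzero flux certifies that the tail integrals defining \<open>f\<close> are genuine,
    so that \<open>f\<close> can be differentiated.\<close>
  obtain c where c: "c \<in> {0<..<\<delta>}" "f c \<noteq> 0"
  proof -
    have "eventually (\<lambda>c. ereal CT < ereal \<bar>f c\<bar>) (at_right 0)"
      by (rule less_LiminfD[OF barrier])
    moreover have "eventually (\<lambda>c. c \<in> {0<..<\<delta>}) (at_right 0)"
      by (rule eventually_at_right_real[OF \<delta>_pos])
    ultimately have "eventually (\<lambda>c. c \<in> {0<..<\<delta>} \<and> f c \<noteq> 0) (at_right 0)"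
      by eventually_elim (use \<open>0 < CT\<close> in auto)
    then show ?thesis
      using that eventually_happens'[OF trivial_limit_at_right_real] by blast
  qed
  have "continuous_on \<Omega> b"
    using local_lipschitz_continuous_on[OF b[unfolded locally_lipschitz_field_def], of 0] by simp
  then have "continuous_on {0<..<\<delta>} I"
    unfolding I_def B using integral_continuous_on_param[of "{0<..<\<delta>}" 0 L "tubular_field b \<gamma> \<kappa>"]
      continuous_on_tubular_field[OF param curvature cont_\<kappa> coordinates] by simp
  moreover have "integral {c..\<delta>} I \<noteq> 0"
    using c(2) by (auto simp: f flux_def I_def[abs_def])
  ultimately have f': "DERIV f x :> 1 / L * I x" if "x \<in> {0<..<\<delta>}" for x
    using DERIV_cmult[OF tail_integral_has_derivative[OF _ c(1) _ that], of I "- (1 / L)"]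
    by (simp add: f flux_def[abs_def] I_def[abs_def])

  have step: "\<exists>n' s'. (s has_real_derivative s') (at t within {0..T}) \<and>
      v t \<bullet> tangent \<gamma> (s t) = s' * (1 - n t * \<kappa> (s t)) \<and>
      (p has_real_derivative - B (n t) (s t) * n'
        - n t * deriv \<kappa> (s t) * s' * (v t \<bullet> tangent \<gamma> (s t))) (at t within {0..T}) \<and>
      (n has_real_derivative n') (at t within {0..T}) \<and> \<bar>n'\<bar> \<le> V"
    if t: "t \<in> {0..T}" for t
  proof -
    obtain n' s' where n': "(n has_real_derivative n') (at t within {0..T})"
      and s': "(s has_real_derivative s') (at t within {0..T})"
      by (rule tubular_coordinates_differentiable[OF coordinates coords q'[OF t] t])
    let ?w = "n' *\<^sub>R normal \<gamma> (s t) + (s' * (1 - n t * \<kappa> (s t))) *\<^sub>R tangent \<gamma> (s t)"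
    have "(q has_vector_derivative ?w) (at t within {0..T})"
      by (rule has_vector_derivative_transform[OF t _ tubular_velocity[OF param curvature n' s']])
        (simp add: coords(4))
    \<comment> \<open>Since \<open>0 < T\<close>, derivatives within \<open>{0..T}\<close> are
      unique even at the end points, and comparing them gives the components of \<open>v t\<close>
      in the moving frame.\<close>
    then have v_eq: "v t = ?w"
      using vector_derivative_unique_within_closed_interval[of 0 T t q "v t" ?w] T t q'[OF t] by simp
    have unit: "tangent \<gamma> x \<bullet> tangent \<gamma> x = 1" "normal \<gamma> x \<bullet> normal \<gamma> x = 1" for x
      using param by (simp_all add: dot_square_norm normal_eq arclength_param_def)
    have u: "v t \<bullet> tangent \<gamma> (s t) = s' * (1 - n t * \<kappa> (s t))" "v t \<bullet> normal \<gamma> (s t) = n'"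
      by (simp_all add: v_eq inner_add_left unit) (simp_all add: normal_eq inner_rot90_left)
    have "\<bar>n'\<bar> \<le> norm (v t) * norm (normal \<gamma> (s t))"
      unfolding u(2)[symmetric] by (rule Cauchy_Schwarz_ineq2)
    also have "\<dots> = V"
      using param by (simp add: speed[OF t] normal_eq arclength_param_def)
    finally show ?thesis
      using tangential_momentum_has_derivative[where b = b and t = t and v = v and n = n and s = s,
          OF param curvature curvature_deriv(1) n' s' _ u]
        v'[OF t] n' s' u(1) unfolding p_def[abs_def] B by (auto simp: coords(4)[OF t])
  qed
  have u_le: "\<bar>v t \<bullet> tangent \<gamma> (s t)\<bar> \<le> V" if "t \<in> {0..T}" for t
    using Cauchy_Schwarz_ineq2[of "v t" "tangent \<gamma> (s t)"] param speed[OF that]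
    by (simp add: arclength_param_def)

  have G': "\<exists>g'. ((\<lambda>t. p t + f (n t)) has_real_derivative g') (at t within {0..T}) \<and> \<bar>g'\<bar> \<le> R"
    if t: "t \<in> {0..T}" for t
  proof -
    define u where "u = v t \<bullet> tangent \<gamma> (s t)"
    define w where "w = 1 - n t * \<kappa> (s t)"
    obtain n' s' where u: "u = s' * w"
      and p': "(p has_real_derivative - B (n t) (s t) * n' - n t * deriv \<kappa> (s t) * s' * u)
        (at t within {0..T})"
      and n': "(n has_real_derivative n') (at t within {0..T})" "\<bar>n'\<bar> \<le> V"
      using step[OF t] unfolding u_def w_def by blast
    have w: "1 - \<epsilon> < w"
      using n\<kappa>[OF t, of "s t"] by (simp add: w_def)
    have "((\<lambda>t. p t + f (n t)) has_real_derivative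
      - B (n t) (s t) * n' - n t * deriv \<kappa> (s t) * s' * u + 1 / L * I (n t) * n') (at t within {0..T})"
      by (rule DERIV_add[OF p' DERIV_chain2[OF f'[OF coords(3)[OF t]] n'(1)]])
    moreover have "\<bar>(B (n t) (s t) - 1 / L * I (n t)) * n'\<bar> \<le> M * V"
      unfolding abs_mult I_def
      by (rule mult_mono) (use M(1) M(2)[OF coords(3)[OF t]] n'(2) in auto)
    moreover have "\<bar>n t * deriv \<kappa> (s t) * s' * u\<bar> \<le> 2 * H0 * K' * \<delta> / (1 - \<epsilon>)"
    proof -
      \<comment> \<open>This form shows that the product is nonnegative, and it bounds the product
        by the energy and the lower bound 1 - \<epsilon> for \<open>w\<close>.\<close>
      have "s' * u = u\<^sup>2 / w"
        using u w \<epsilon> by (simp add: power2_eq_square)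
      moreover have "u\<^sup>2 \<le> 2 * H0"
        using u_le[OF t] V unfolding u_def by (metis abs_le_square_iff abs_of_pos)
      ultimately have "0 \<le> s' * u" "s' * u \<le> 2 * H0 / (1 - \<epsilon>)"
        using w \<epsilon> moving by (auto intro!: frac_le)
      then have "\<bar>s' * u\<bar> \<le> 2 * H0 / (1 - \<epsilon>)"
        by simp
      moreover have "\<bar>n t * deriv \<kappa> (s t)\<bar> \<le> \<delta> * K'"
        unfolding abs_mult by (rule mult_mono) (use coords(3)[OF t] d\<kappa>_le in auto)
      ultimately have "\<bar>n t * deriv \<kappa> (s t)\<bar> * \<bar>s' * u\<bar> \<le> \<delta> * K' * (2 * H0 / (1 - \<epsilon>))"
        by (intro mult_mono) (use \<delta>_pos K'_nonneg in auto)
      then show ?thesis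
        by (simp add: abs_mult mult_ac)
    qed
    \<comment> \<open>Regrouping lets the derivative of the flux cancel the mean part of
      \<open>B\<close>, leaving the deviation bounded by \<open>M\<close>.\<close>
    moreover have "- B (n t) (s t) * n' - n t * deriv \<kappa> (s t) * s' * u + 1 / L * I (n t) * n' =
        - ((B (n t) (s t) - 1 / L * I (n t)) * n') - n t * deriv \<kappa> (s t) * s' * u"
      by (simp add: algebra_simps)
    ultimately show ?thesis
      unfolding R_def by (intro exI conjI) (assumption, linarith)
  qed
  then obtain G' where G': "\<And>t. t \<in> {0..T} \<Longrightarrow>
      ((\<lambda>t. p t + f (n t)) has_real_derivative G' t) (at t within {0..T})"
    "\<And>t. t \<in> {0..T} \<Longrightarrow> \<bar>G' t\<bar> \<le> R"
    by metis
  \<comment> \<open>One factor of the square comes from the definition of \<open>p\<close>, the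
    other from the tangential velocity \<open>s' * (1 - n * \<kappa>)\<close>.\<close>
  have p0: "p 0 = sdot0 * (1 - \<kappa> (s 0) * n 0)\<^sup>2"
  proof -
    obtain s' where s': "(s has_real_derivative s') (at 0 within {0..T})"
      "v 0 \<bullet> tangent \<gamma> (s 0) = s' * (1 - n 0 * \<kappa> (s 0))"
      using step[of 0] T by auto
    have "s' = sdot0"
      using vector_derivative_unique_within_closed_interval[of 0 T 0 s s' sdot0] s'(1) sdot0 T
      by (simp add: has_real_derivative_iff_has_vector_derivative)
    then show ?thesis
      by (simp add: p_def s'(2) power2_eq_square mult.commute)
  qed
  \<comment> \<open>|f| is at most |p + f| + |p|. The first term grows from its initial value by at
    most \<open>R * T\<close>; the second is strictly below \<open>V * (1 + \<epsilon>)\<close>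
    because \<open>n t < \<delta>\<close>, and this makes the whole bound strict.\<close>
  have f_less: "\<bar>f (n t)\<bar> < CT" if t: "t \<in> {0..T}" for t
  proof -
    have "\<bar>(p t + f (n t)) - (p 0 + f (n 0))\<bar> \<le> R * \<bar>t - 0\<bar>"
      using field_differentiable_bound[OF _ G'(1) _ t, of R 0] G'(2) T by simp
    moreover have "R * \<bar>t - 0\<bar> \<le> R * T"
      using t R_nonneg by (simp add: mult_left_mono)
    moreover have "\<bar>p t\<bar> < V * (1 + \<epsilon>)"
    proof -
      have "\<bar>p t\<bar> \<le> V * \<bar>1 - n t * \<kappa> (s t)\<bar>"
        unfolding p_def abs_mult by (intro mult_right_mono u_le t) simp
      also have "\<dots> < V * (1 + \<epsilon>)"
        using V n\<kappa>[OF t, of "s t"] by (intro mult_strict_left_mono) linarith+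
      finally show ?thesis .
    qed
    ultimately show ?thesis
      unfolding CT_eq p0[symmetric] by linarith
  qed

  have n_mem: "n t \<in> {0<..\<delta>}" if "t \<in> {0..T}" for t
    using coords(3)[OF that] by simp
  have "CT \<in> g ` {0<..\<delta>} \<and> (\<forall>t\<in>{0..<T}. the_inv_into {0<..\<delta>} g CT < n t)"
    if g: "minorant f \<delta> g" for g
  proof -
    have 0: "0 \<in> {0..T}"
      using T by simp
    note cross = minorant_crossing[OF g barrier n_mem[OF 0] f_less[OF 0]]
    show ?thesis
      using cross(1) cross(2)[OF n_mem f_less] by auto
  qed
  then show ?thesis
    using exists_minorant[OF \<delta>_pos] by blast
qed

end
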